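(* Let $1 \leq t \leq r_1 \leq \dots \leq r_k$ (with $k\geq 2$), and for each $i \in [k]$ let $\mathcal{F}_i$ be a $(\leq r_i)$-family with $l(\mathcal{F}_i,t) \geq c(r_{k-1},r_k,t)\, l(\mathcal{F}_i,t+1)$. Then $(\mathcal{F}_1, \dots, \mathcal{F}_k)$ has the strict cross-$t$-star property.
   Context: All sets and families are finite; $[k]=\{1,\dots,k\}$. A set $A$ $t$-intersects $B$ if $|A\cap B|\geq t$. Families $\mathcal{A}_1,\dots,\mathcal{A}_k$ are cross-$t$-intersecting if for all distinct $i,j\in[k]$ each set of $\mathcal{A}_i$ $t$-intersects each set of $\mathcal{A}_j$; then the tuple $(\mathcal{A}_1,\dots,\mathcal{A}_k)$ is called cross-$t$-intersecting. The tuple is below $(\mathcal{F}_1,\dots,\mathcal{F}_k)$ if $\mathcal{A}_i\subseteq\mathcal{F}_i$ for all $i$. $\mathcal{F}(T)=\{F\in\mathcal{F}:T\subseteq F\}$; $l(\mathcal{F},t)=\max_{|T|=t}|\mathcal{F}(T)|$. A $(\leq r)$-family is one whose sets each have at most $r$ elements. $c(r,s,t)=\max\{r\binom{s}{t},s\binom{r}{t}\}+1$ if $t\leq\min\{r,s\}$ and $c(r,s,t)=1$ otherwise. $(\mathcal{F}_1,\dots,\mathcal{F}_k)$ has the strict cross-$t$-star property if for every cross-$t$-intersecting tuple $(\mathcal{A}_1,\dots,\mathcal{A}_k)$ below it, $\prod_{i=1}^k|\mathcal{A}_i|\leq\prod_{i=1}^k l(\mathcal{F}_i,t)$, with strict inequality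 unless there is a $t$-set $T$ with $\mathcal{A}_i=\mathcal{F}_i(T)$ for every $i\in[k]$.
   Formalization: The formal theorem adds the hypothesis l(F_i,t) > 0 for every i; without it the strictness claim fails, e.g. for t=1, k=2, r_1=r_2=1, F_1={∅}, F_2={{1},{2}} and the tuple (∅,F_2), where both products are 0. *)

theory Defs
  imports Complex_Main
begin

definition t_intersects :: "nat \<Rightarrow> 'a set \<Rightarrow> 'a set \<Rightarrow> bool" where
  "t_intersects t A B \<longleftrightarrow> t \<le> card (A \<inter> B)"

text \<open>A tuple of \<open>k\<close> families is a function on \<open>nat\<close>, of which only the values on
  \<open>{1..k}\<close> are used.\<close>

definition cross_t_intersecting :: "nat \<Rightarrow> nat \<Rightarrow> (nat \<Rightarrow> 'a set set) \<Rightarrow> bool" where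
  "cross_t_intersecting t k \<A> \<longleftrightarrow>
     (\<forall>i\<in>{1..k}. \<forall>j\<in>{1..k}. i \<noteq> j \<longrightarrow> (\<forall>A\<in>\<A> i. \<forall>B\<in>\<A> j. t_intersects t A B))"

definition below :: "nat \<Rightarrow> (nat \<Rightarrow> 'a set set) \<Rightarrow> (nat \<Rightarrow> 'a set set) \<Rightarrow> bool" where
  "below k \<A> \<F> \<longleftrightarrow> (\<forall>i\<in>{1..k}. \<A> i \<subseteq> \<F> i)"

definition star :: "'a set set \<Rightarrow> 'a set \<Rightarrow> 'a set set" where
  "star \<F> T = {F \<in> \<F>. T \<subseteq> F}"

text \<open>The maximum size of \<open>star \<F> T\<close> over all \<open>t\<close>-sets \<open>T\<close>, meant for finite \<open>\<F>\<close>. Inserting \<open>0\<close>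
  matters only if the type \<open>'a\<close> has fewer than \<open>t\<close> elements, where \<open>Max {}\<close> would be
  unspecified.\<close>

definition max_star :: "'a set set \<Rightarrow> nat \<Rightarrow> nat" where
  "max_star \<F> t = Max (insert 0 {card (star \<F> T) | T. finite T \<and> card T = t})"

definition le_family :: "nat \<Rightarrow> 'a set set \<Rightarrow> bool" where
  "le_family r \<F> \<longleftrightarrow> finite \<F> \<and> (\<forall>F\<in>\<F>. finite F \<and> card F \<le> r)"

definition c :: "nat \<Rightarrow> nat \<Rightarrow> nat \<Rightarrow> nat" where
  "c r s t = (if t \<le> min r s then max (r * (s choose t)) (s * (r choose t)) + 1 else 1)"

definition strict_cross_t_star :: "nat \<Rightarrow> nat \<Rightarrow> (nat \<Rightarrow> 'a set set) \<Rightarrow> bool" where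
  "strict_cross_t_star t k \<F> \<longleftrightarrow>
     (\<forall>\<A>. cross_t_intersecting t k \<A> \<and> below k \<A> \<F> \<longrightarrow>
        (\<Prod>i=1..k. card (\<A> i)) \<le> (\<Prod>i=1..k. max_star (\<F> i) t) \<and>
        ((\<nexists>T. finite T \<and> card T = t \<and> (\<forall>i\<in>{1..k}. \<A> i = star (\<F> i) T)) \<longrightarrow>
          (\<Prod>i=1..k. card (\<A> i)) < (\<Prod>i=1..k. max_star (\<F> i) t)))"

end

theory Submission
  imports Defs
begin

text \<open>For two nonempty cross-\<open>t\<close>-intersecting families, the sets of each are covered by the stars of
  the \<open>t\<close>-subsets of a single member of the other. If a \<open>t\<close>-set \<open>T\<close> fails to lie in some member
  \<open>B\<close> of the other family, then every set containing \<open>T\<close> must also meet \<open>B - T\<close>, so the star of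
  \<open>T\<close> is covered by at most \<open>card B\<close> stars of \<open>(t + 1)\<close>-sets. Hence the
  product of the sizes is too small unless both families lie in the star of the same \<open>t\<close>-set.
  For \<open>k\<close> families, the bound on pairs shows that at most one family can exceed its largest star,
  and that its excess is compensated by any other family.\<close>

section \<open>Sizes of stars and covers by stars\<close>

lemma card_star_le_max_star:
  assumes "finite \<F>" "finite T" "card T = t"
  shows "card (star \<F> T) \<le> max_star \<F> t"
proof -
  \<comment> \<open>There may be infinitely many \<open>t\<close>-sets, but the star sizes are
    bounded by \<open>card \<F>\<close> and so form a finite set, as \<open>Max_ge\<close>
    requires.\<close>
  have "{card (star \<F> T) | T. finite T \<and> card T = t} \<subseteq> {..card \<F>}"
    using assms(1) by (auto simp: star_def intro: card_mono)
  then have "finite (insert 0 {card (star \<F> T) | T. finite T \<and> card T = t})"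
    using finite_subset by blast
  then show ?thesis
    unfolding max_star_def using assms(2,3) by (intro Max_ge) auto
qed

lemma card_star_insert_le_max_star:
  assumes "finite \<F>" "finite T" "card T = t" "x \<notin> T"
  shows "card (star \<F> (insert x T)) \<le> max_star \<F> (t + 1)"
  using assms by (intro card_star_le_max_star) auto

lemma card_UN_le_mult:
  assumes "finite I" "\<And>i. i \<in> I \<Longrightarrow> card (S i) \<le> m" "card I \<le> n"
  shows "card (\<Union>i\<in>I. S i) \<le> n * m"
proof -
  have "card (\<Union>i\<in>I. S i) \<le> (\<Sum>i\<in>I. card (S i))"
    using assms(1) by (rule card_UN_le)
  also have "\<dots> \<le> card I * m"
    using assms(2) by (metis sum_bounded_above of_nat_id)
  also have "\<dots> \<le> n * m"
    using assms(3) by simp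
  finally show ?thesis .
qed

lemma finite_star: "finite \<F> \<Longrightarrow> finite (star \<F> T)"
  by (simp add: star_def)

lemma star_mono: "\<A> \<subseteq> \<F> \<Longrightarrow> star \<A> T \<subseteq> star \<F> T"
  by (auto simp: star_def)

lemma star_eq_self: "(\<And>A. A \<in> \<A> \<Longrightarrow> T \<subseteq> A) \<Longrightarrow> star \<A> T = \<A>"
  by (auto simp: star_def)

text \<open>Fewer than \<open>t\<close> points of \<open>B\<close> lie in \<open>T\<close>, so a
  member of \<open>star \<A> T\<close> must contain a further point of \<open>B\<close>.\<close>

lemma card_star_le_of_not_subset:
  assumes "finite \<F>" "\<A> \<subseteq> \<F>" "finite T" "card T = t"
    and "finite B" "card B \<le> s" "\<not> T \<subseteq> B"
    and int: "\<And>A. A \<in> \<A> \<Longrightarrow> t_intersects t A B"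
  shows "card (star \<A> T) \<le> s * max_star \<F> (t + 1)"
proof -
  have "\<exists>x\<in>B - T. x \<in> A" if "A \<in> \<A>" for A
  proof (rule ccontr)
    assume "\<not> (\<exists>x\<in>B - T. x \<in> A)"
    then have "A \<inter> B \<subset> T"
      using \<open>\<not> T \<subseteq> B\<close> by auto
    then have "card (A \<inter> B) < t"
      using assms(3,4) psubset_card_mono by blast
    then show False
      using int[OF that] by (simp add: t_intersects_def)
  qed
  then have "star \<A> T \<subseteq> (\<Union>x\<in>B - T. star \<F> (insert x T))"
    using \<open>\<A> \<subseteq> \<F>\<close> by (fastforce simp: star_def)
  moreover have "finite (\<Union>x\<in>B - T. star \<F> (insert x T))"
    using assms by (simp add: finite_star)
  ultimately have "card (star \<A> T) \<le> card (\<Union>x\<in>B - T. star \<F> (insert x T))"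
    by (rule card_mono[rotated])
  also have "\<dots> \<le> s * max_star \<F> (t + 1)"
  proof (rule card_UN_le_mult)
    show "card (B - T) \<le> s"
      using assms(5,6) by (meson card_mono Diff_subset order_trans)
  qed (use assms in \<open>auto intro!: card_star_insert_le_max_star[simplified]\<close>)
  finally show ?thesis .
qed

text \<open>The bound \<open>m\<close> is left open for two uses: \<open>max_star \<F> t\<close> in
  general, and \<open>s * max_star \<F> (t + 1)\<close> when no \<open>t\<close>-set lies in all
  sets of the other family.\<close>

lemma card_le_binomial_mult:
  assumes "finite \<A>" "finite B" "card B \<le> s"
    and int: "\<And>A. A \<in> \<A> \<Longrightarrow> t_intersects t A B"
    and star: "\<And>T. finite T \<Longrightarrow> card T = t \<Longrightarrow> card (star \<A> T) \<le> m"
  shows "card \<A> \<le> (s choose t) * m"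
proof -
  let ?I = "{T. T \<subseteq> B \<and> card T = t}"
  have I: "finite ?I" "card ?I \<le> s choose t"
    using assms(2,3) by (auto simp: n_subsets binomial_right_mono)
  have "\<A> \<subseteq> (\<Union>T\<in>?I. star \<A> T)"
  proof
    fix A assume "A \<in> \<A>"
    then have "t \<le> card (A \<inter> B)"
      using int by (simp add: t_intersects_def)
    then obtain T where "T \<subseteq> A \<inter> B" "card T = t"
      by (meson obtain_subset_with_card_n)
    then show "A \<in> (\<Union>T\<in>?I. star \<A> T)"
      using \<open>A \<in> \<A>\<close> by (auto simp: star_def)
  qed
  moreover have "finite (\<Union>T\<in>?I. star \<A> T)"
    using I assms(1) by (simp add: finite_star)
  ultimately have "card \<A> \<le> card (\<Union>T\<in>?I. star \<A> T)"
    by (rule card_mono[rotated])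
  also have "\<dots> \<le> (s choose t) * m"
    using I assms(2) star by (intro card_UN_le_mult) (auto intro: finite_subset)
  finally show ?thesis .
qed

lemma card_le_binomial_mult_max_star:
  assumes "finite \<F>" "\<A> \<subseteq> \<F>" "finite B" "card B \<le> s"
    and "\<And>A. A \<in> \<A> \<Longrightarrow> t_intersects t A B"
  shows "card \<A> \<le> (s choose t) * max_star \<F> t"
proof (rule card_le_binomial_mult[where B = B])
  show "card (star \<A> T) \<le> max_star \<F> t" if "finite T" "card T = t" for T
    using card_mono[OF finite_star star_mono] card_star_le_max_star assms(1,2) that
    by (meson order_trans)
qed (use assms finite_subset in auto)

section \<open>Products for two families\<close>

lemma mult_less_of_scaled_le:
  fixes p m x y :: nat
  assumes "p < m" "m * x \<le> y" "0 < y"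
  shows "p * x < y"
  \<comment> \<open>For \<open>x = 0\<close> the second assumption says nothing about
    \<open>y\<close>, and strictness comes from \<open>0 < y\<close>.\<close>
  using assms by (cases "x = 0") (auto intro: less_le_trans[of _ "m * x"])

text \<open>The set \<open>B0\<close> makes all of \<open>\<A>\<close>, which is its own star at
  \<open>T\<close>, small; for \<open>\<B>\<close> the crude cover by stars of
  \<open>t\<close>-subsets of one member of \<open>\<A>\<close> is enough. The constants multiply to
  \<open>s * (r choose t)\<close>, one of the two terms in \<open>c\<close>.\<close>

lemma prod_less_if_common_subset:
  assumes F: "finite \<F>" and G: "finite \<G>" and A: "\<A> \<subseteq> \<F>" and B: "\<B> \<subseteq> \<G>" and "\<A> \<noteq> {}"
    and "\<And>A. A \<in> \<A> \<Longrightarrow> finite A \<and> card A \<le> r" "\<And>B. B \<in> \<B> \<Longrightarrow> finite B \<and> card B \<le> s"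
    and int: "\<And>A B. A \<in> \<A> \<Longrightarrow> B \<in> \<B> \<Longrightarrow> t_intersects t A B"
    and T: "finite T" "card T = t" "\<And>A. A \<in> \<A> \<Longrightarrow> T \<subseteq> A"
    and B0: "B0 \<in> \<B>" "\<not> T \<subseteq> B0"
    and m: "s * (r choose t) < m" "m * max_star \<F> (t + 1) \<le> max_star \<F> t"
    and pos: "0 < max_star \<F> t" "0 < max_star \<G> t"
  shows "card \<A> * card \<B> < max_star \<F> t * max_star \<G> t"
proof -
  obtain A0 where A0: "A0 \<in> \<A>"
    using \<open>\<A> \<noteq> {}\<close> by blast
  have "card (star \<A> T) \<le> s * max_star \<F> (t + 1)"
    using assms by (intro card_star_le_of_not_subset[where B = B0]) auto
  then have a: "card \<A> \<le> s * max_star \<F> (t + 1)"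
    using star_eq_self[OF T(3)] by simp
  have b: "card \<B> \<le> (r choose t) * max_star \<G> t"
    using assms(6)[OF A0] int[OF A0] G B by (intro card_le_binomial_mult_max_star[where B = A0])
      (auto simp: t_intersects_def Int_commute)
  have "card \<A> * card \<B> \<le> (s * (r choose t) * max_star \<F> (t + 1)) * max_star \<G> t"
    using mult_le_mono[OF a b] by (simp add: mult_ac)
  also have "\<dots> < max_star \<F> t * max_star \<G> t"
    using mult_less_of_scaled_le[OF m pos(1)] pos(2) by simp
  finally show ?thesis .
qed

text \<open>Every \<open>t\<close>-set fails to lie in some \<open>B\<close> of \<open>\<B>\<close>,
  which may depend on the \<open>t\<close>-set, so all its stars in \<open>\<A>\<close> are small.
  The fixed \<open>B0\<close> supplies the \<open>t\<close>-sets whose stars cover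
  \<open>\<A>\<close>.\<close>

lemma card_le_if_no_common_subset:
  assumes "finite \<F>" "\<A> \<subseteq> \<F>" "B0 \<in> \<B>"
    and B: "\<And>B. B \<in> \<B> \<Longrightarrow> finite B \<and> card B \<le> s"
    and int: "\<And>A B. A \<in> \<A> \<Longrightarrow> B \<in> \<B> \<Longrightarrow> t_intersects t A B"
    and no: "\<nexists>T. finite T \<and> card T = t \<and> (\<forall>B\<in>\<B>. T \<subseteq> B)"
  shows "card \<A> \<le> (s choose t) * (s * max_star \<F> (t + 1))"
proof (rule card_le_binomial_mult[where B = B0])
  fix T :: "'a set" assume T: "finite T" "card T = t"
  then obtain B where "B \<in> \<B>" "\<not> T \<subseteq> B"
    using no by blast
  then show "card (star \<A> T) \<le> s * max_star \<F> (t + 1)"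
    using assms T by (intro card_star_le_of_not_subset[where B = B]) auto
qed (use assms finite_subset in auto)

lemma prod_less_or_star:
  assumes F: "le_family r \<F>" and G: "le_family s \<G>" and A: "\<A> \<subseteq> \<F>" and B: "\<B> \<subseteq> \<G>"
    and int: "\<And>A B. A \<in> \<A> \<Longrightarrow> B \<in> \<B> \<Longrightarrow> t_intersects t A B"
    and m: "r * (s choose t) < m" "s * (r choose t) < m"
    and mF: "m * max_star \<F> (t + 1) \<le> max_star \<F> t" "0 < max_star \<F> t"
    and mG: "m * max_star \<G> (t + 1) \<le> max_star \<G> t" "0 < max_star \<G> t"
  shows "card \<A> * card \<B> < max_star \<F> t * max_star \<G> t \<or>
    (\<exists>T. finite T \<and> card T = t \<and> \<A> = star \<F> T \<and> \<B> = star \<G> T)"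
proof -
  have fin: "finite \<F>" "finite \<G>"
    using F G by (auto simp: le_family_def)
  have le: "\<And>A. A \<in> \<A> \<Longrightarrow> finite A \<and> card A \<le> r" "\<And>B. B \<in> \<B> \<Longrightarrow> finite B \<and> card B \<le> s"
    using F G A B by (auto simp: le_family_def)
  have int': "t_intersects t B A" if "A \<in> \<A>" "B \<in> \<B>" for A B
    using int[OF that] by (simp add: t_intersects_def Int_commute)
  consider (empty) "\<A> = {} \<or> \<B> = {}"
    | (both) T where "finite T" "card T = t" "\<And>A. A \<in> \<A> \<Longrightarrow> T \<subseteq> A" "\<And>B. B \<in> \<B> \<Longrightarrow> T \<subseteq> B"
    | (left) T B0 where "\<A> \<noteq> {}" "finite T" "card T = t" "\<And>A. A \<in> \<A> \<Longrightarrow> T \<subseteq> A" "B0 \<in> \<B>" "\<not> T \<subseteq> B0"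
    | (right) T A0 where "\<B> \<noteq> {}" "finite T" "card T = t" "\<And>B. B \<in> \<B> \<Longrightarrow> T \<subseteq> B" "A0 \<in> \<A>" "\<not> T \<subseteq> A0"
    | (none) A0 B0 where "A0 \<in> \<A>" "B0 \<in> \<B>"
        "\<nexists>T. finite T \<and> card T = t \<and> (\<forall>A\<in>\<A>. T \<subseteq> A)"
        "\<nexists>T. finite T \<and> card T = t \<and> (\<forall>B\<in>\<B>. T \<subseteq> B)"
    by (metis ex_in_conv)
  then show ?thesis
  proof cases
    case empty
    then show ?thesis
      using mF mG by auto
  next
    case both
    have sub: "\<A> \<subseteq> star \<F> T" "\<B> \<subseteq> star \<G> T"
      using both A B by (auto simp: star_def)
    have st: "card (star \<F> T) \<le> max_star \<F> t" "card (star \<G> T) \<le> max_star \<G> t"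
      using both fin by (auto intro: card_star_le_max_star)
    have le: "card \<A> \<le> max_star \<F> t" "card \<B> \<le> max_star \<G> t"
      using sub st card_mono[OF finite_star] fin by (meson order_trans)+
    show ?thesis
    proof (cases "\<A> = star \<F> T \<and> \<B> = star \<G> T")
      case True
      then show ?thesis
        using both by blast
    next
      case False
      then have "card \<A> < max_star \<F> t \<or> card \<B> < max_star \<G> t"
        using sub st psubset_card_mono[OF finite_star] fin by (metis less_le_trans psubsetI)
      then have "card \<A> * card \<B> < max_star \<F> t * max_star \<G> t"
        using le mF(2) mG(2)
        by (metis mult_is_0 mult_le_less_imp_less mult_less_le_imp_less not_gr0 zero_le)
      then show ?thesis ..
    qed
  next
    case left
    have "card \<A> * card \<B> < max_star \<F> t * max_star \<G> t"
      by (rule prod_less_if_common_subset[OF fin A B left(1) le int left(2-6) m(2) mF(1) mF(2) mG(2)])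
    then show ?thesis ..
  next
    case right
    have "card \<B> * card \<A> < max_star \<G> t * max_star \<F> t"
      by (rule prod_less_if_common_subset[OF fin(2,1) B A right(1) le(2,1) int' right(2-6) m(1) mG(1) mG(2) mF(2)])
    then show ?thesis
      by (simp add: mult.commute)
  next
    case none
    have a: "card \<A> \<le> (s choose t) * (s * max_star \<F> (t + 1))"
      by (rule card_le_if_no_common_subset[OF fin(1) A none(2) le(2) int none(4)])
    have b: "card \<B> \<le> (r choose t) * (r * max_star \<G> (t + 1))"
      by (rule card_le_if_no_common_subset[OF fin(2) B none(1) le(1) int' none(3)])
    \<comment> \<open>The binomials are exchanged between the two bounds, so that each factor
      carries a constant known to be less than \<open>m\<close>; no bound on
      \<open>s * (s choose t)\<close> or \<open>r * (r choose t)\<close> is assumed.\<close>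
    have "card \<A> * card \<B> \<le>
      (s * (r choose t) * max_star \<F> (t + 1)) * (r * (s choose t) * max_star \<G> (t + 1))"
      using mult_le_mono[OF a b] by (simp add: mult_ac)
    also have "\<dots> < max_star \<F> t * max_star \<G> t"
      by (intro mult_strict_mono mult_less_of_scaled_le[OF m(1) mG]
          mult_less_of_scaled_le[OF m(2) mF] mF(2)) auto
    finally show ?thesis ..
  qed
qed

section \<open>From pairs to \<open>k\<close> families\<close>

text \<open>Equal stars of two different \<open>t\<close>-sets would lie in the star of a
  \<open>(t + 1)\<close>-set and so be too small. This identifies the \<open>t\<close>-sets obtained
  from different pairs of families.\<close>

lemma star_inj_of_max_star_less:
  assumes "finite \<F>" "finite T" "finite T'" "card T = t" "card T' = t"
    and "star \<F> T = star \<F> T'" "max_star \<F> (t + 1) < card (star \<F> T)"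
  shows "T = T'"
proof (rule ccontr)
  assume "T \<noteq> T'"
  then obtain x where x: "x \<in> T'" "x \<notin> T"
    using assms card_subset_eq by (metis subsetI)
  then have "star \<F> T = star \<F> (insert x T)"
    using assms(6) by (auto simp: star_def)
  then show False
    using card_star_insert_le_max_star[of \<F> T t x] assms x by simp
qed

text \<open>The default value 1 of \<open>c\<close> does not exceed any value of the main case,
  thanks to the \<open>+ 1\<close> there, so monotonicity survives the change of case.\<close>

lemma c_mono: "r \<le> r' \<Longrightarrow> s \<le> s' \<Longrightarrow> c r s t \<le> c r' s' t"
  using max.mono[OF mult_le_mono[OF _ binomial_right_mono] mult_le_mono[OF _ binomial_right_mono],
      of r r' s s' s s' r r' t t]
  by (auto simp: c_def)

text \<open>An excess of \<open>a\<close> over \<open>l\<close> at \<open>m\<close> forces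
  \<open>a i \<le> l i\<close> at all other indices. The pair \<open>m\<close>, \<open>j\<close>
  absorbs the excess, and the remaining factors are compared one by one.\<close>

lemma prod_less_of_pairwise:
  fixes a l :: "'i \<Rightarrow> nat"
  assumes "finite I" "m \<in> I" "j \<in> I" "j \<noteq> m" "l m < a m"
    and pair: "\<And>i. i \<in> I \<Longrightarrow> i \<noteq> m \<Longrightarrow> a m * a i < l m * l i"
    and pos: "\<And>i. i \<in> I \<Longrightarrow> 0 < l i"
  shows "prod a I < prod l I"
proof -
  have le: "a i \<le> l i" if "i \<in> I" "i \<noteq> m" for i
  proof (rule ccontr)
    assume "\<not> a i \<le> l i"
    then have "l m * l i \<le> a m * a i"
      using \<open>l m < a m\<close> by (intro mult_le_mono) auto
    then show False
      using pair[OF that] by simp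
  qed
  have split: "prod f I = f m * f j * prod f (I - {m} - {j})" for f :: "'i \<Rightarrow> nat"
    using assms(1-4) by (simp add: prod.remove[of I m] prod.remove[of "I - {m}" j] mult.assoc)
  have "prod a I \<le> a m * a j * prod l (I - {m} - {j})"
    unfolding split[of a] using le by (intro mult_le_mono prod_mono) auto
  also have "\<dots> < l m * l j * prod l (I - {m} - {j})"
    using pair[of j] assms(3,4) pos by (intro mult_strict_right_mono prod_pos) auto
  also have "\<dots> = prod l I"
    by (rule split[symmetric])
  finally show ?thesis .
qed

text \<open>\<open>nondegenerate\<close> keeps the right-hand product positive. If it is 0, no tuple
  satisfies the strict inequality, not even one without a common \<open>t\<close>-set: take
  \<open>k = 2\<close>, \<open>\<F> 1 = {}\<close>, and \<open>\<A> 2 = \<F> 2\<close> consisting of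
  two disjoint \<open>t\<close>-sets.\<close>

theorem theorem2p6:
  fixes t k :: nat and r :: "nat \<Rightarrow> nat" and \<F> :: "nat \<Rightarrow> 'a set set"
  assumes "2 \<le> k"
    and "1 \<le> t" and "t \<le> r 1" and "mono_on {1..k} r"
    and "\<And>i. i \<in> {1..k} \<Longrightarrow> le_family (r i) (\<F> i)"
    and "\<And>i. i \<in> {1..k} \<Longrightarrow> max_star (\<F> i) t \<ge> c (r (k - 1)) (r k) t * max_star (\<F> i) (t + 1)"
    and nondegenerate: "\<And>i. i \<in> {1..k} \<Longrightarrow> max_star (\<F> i) t > 0"
  shows "strict_cross_t_star t k \<F>"
proof -
  let ?m = "c (r (k - 1)) (r k) t"
  let ?l = "\<lambda>i. max_star (\<F> i) t"
  have fin: "finite (\<F> i)" if "i \<in> {1..k}" for i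
    using assms(5)[OF that] by (simp add: le_family_def)
  have t_le: "t \<le> r i" if "i \<in> {1..k}" for i
    using mono_onD[OF assms(4), of 1 i] that assms(3) by auto
  have c_gt: "r i * (r j choose t) < ?m \<and> r j * (r i choose t) < ?m"
    if "i \<in> {1..k}" "j \<in> {1..k}" "i < j" for i j
  proof -
    \<comment> \<open>The smaller of two distinct indices is at most \<open>k - 1\<close>, so the
      constant for \<open>r (k - 1)\<close> and \<open>r k\<close> serves every pair.\<close>
    have "r i \<le> r (k - 1)" "r j \<le> r k"
      using mono_onD[OF assms(4), of i "k - 1"] mono_onD[OF assms(4), of j k] that by auto
    then have "c (r i) (r j) t \<le> ?m"
      by (rule c_mono)
    then show ?thesis
      using t_le that by (auto simp: c_def)
  qed
  \<comment> \<open>This product is positive, hence \<open>1 < ?m\<close>, and the maximum star size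
    drops strictly from \<open>t\<close> to \<open>t + 1\<close>, as needed to identify
    \<open>t\<close>-sets below.\<close>
  have "r 1 * (r 2 choose t) < ?m" "0 < r 1" "t \<le> r 2"
    using c_gt[of 1 2] t_le[of 2] assms(1-3) by auto
  then have "1 < ?m"
    using zero_less_binomial[of t "r 2"] by (metis less_one linorder_neqE_nat
      mult_is_0 not_less_iff_gr_or_eq order_less_trans)
  have succ_less: "max_star (\<F> i) (t + 1) < ?l i" if "i \<in> {1..k}" for i
    using mult_less_of_scaled_le[OF \<open>1 < ?m\<close> assms(6)[OF that] nondegenerate[OF that]] by simp
  have main: "prod (\<lambda>i. card (\<A> i)) {1..k} < prod ?l {1..k} \<or>
      (\<exists>T. finite T \<and> card T = t \<and> (\<forall>i\<in>{1..k}. \<A> i = star (\<F> i) T))"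
    if cross: "cross_t_intersecting t k \<A>" and below: "below k \<A> \<F>" for \<A>
  proof -
    let ?a = "\<lambda>i. card (\<A> i)"
    have pair: "?a i * ?a j < ?l i * ?l j \<or>
        (\<exists>T. finite T \<and> card T = t \<and> \<A> i = star (\<F> i) T \<and> \<A> j = star (\<F> j) T)"
      if "i \<in> {1..k}" "j \<in> {1..k}" "i \<noteq> j" for i j
    proof (rule prod_less_or_star)
      show "r i * (r j choose t) < ?m" "r j * (r i choose t) < ?m"
        using c_gt[of i j] c_gt[of j i] that by (meson linorder_neqE_nat)+
      show "t_intersects t A B" if "A \<in> \<A> i" "B \<in> \<A> j" for A B
        using cross \<open>i \<in> {1..k}\<close> \<open>j \<in> {1..k}\<close> \<open>i \<noteq> j\<close> that
        unfolding cross_t_intersecting_def by blast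
    qed (use that assms(5-) below in \<open>auto simp: below_def\<close>)
    show ?thesis
    proof (cases "\<exists>m\<in>{1..k}. ?l m < ?a m")
      case True
      then obtain m where m: "m \<in> {1..k}" "?l m < ?a m"
        by blast
      \<comment> \<open>The star alternative in \<open>pair\<close> would give
        \<open>?a m \<le> ?l m\<close>, against the choice of \<open>m\<close>.\<close>
      have "?a m * ?a i < ?l m * ?l i" if "i \<in> {1..k}" "i \<noteq> m" for i
        using pair[of m i] m that card_star_le_max_star[OF fin[OF m(1)]]
        by (metis not_le)
      moreover have "(if m = 1 then 2 else 1) \<in> {1..k}" "(if m = 1 then 2 else 1) \<noteq> m"
        using assms(1) by auto
      ultimately have "prod ?a {1..k} < prod ?l {1..k}"
        using m nondegenerate by (intro prod_less_of_pairwise) auto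
      then show ?thesis ..
    next
      case False
      then have le: "?a i \<le> ?l i" if "i \<in> {1..k}" for i
        using that by (meson not_le)
      show ?thesis
      proof (cases "\<forall>i\<in>{1..k}. ?a i = ?l i")
        case eq: True
        \<comment> \<open>When all sizes attain their bounds, the strict alternative in
          \<open>pair\<close> is impossible. The set \<open>T\<close> may still depend on
          \<open>j\<close>; the family \<open>\<A> 1\<close> is the common reference by which these
          sets are shown equal.\<close>
        have ex: "\<exists>T. finite T \<and> card T = t \<and> \<A> 1 = star (\<F> 1) T \<and> \<A> j = star (\<F> j) T"
          if "j \<in> {1..k}" "j \<noteq> 1" for j
          using pair[of 1 j] eq that by auto
        have one: "1 \<in> {1..k}"
          using assms(1) by simp
        obtain T where T: "finite T" "card T = t" "\<A> 1 = star (\<F> 1) T"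
          using ex[of 2] assms(1) by auto
        have "\<A> j = star (\<F> j) T" if "j \<in> {1..k}" for j
        proof (cases "j = 1")
          case False
          then obtain T' where T': "finite T'" "card T' = t" "\<A> 1 = star (\<F> 1) T'" "\<A> j = star (\<F> j) T'"
            using ex \<open>j \<in> {1..k}\<close> by blast
          have "card (star (\<F> 1) T) = ?l 1"
            using eq one T(3) by metis
          then have "T = T'"
            using T T' succ_less[OF one]
            by (intro star_inj_of_max_star_less[OF fin[OF one]]) auto
          then show ?thesis
            using T' by simp
        qed (use T in simp)
        then show ?thesis
          using T by blast
      next
        case False
        then obtain i where i: "i \<in> {1..k}" "?a i < ?l i"
          using le by (meson le_neq_implies_less)
        \<comment> \<open>Strictness at \<open>i\<close> survives multiplication because the other
          bounds are positive.\<close>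
        have "prod ?a {1..k} < prod ?l {1..k}"
          using i le nondegenerate
          unfolding prod.remove[OF finite_atLeastAtMost i(1)]
          by (intro le_less_trans[OF mult_le_mono2 mult_strict_right_mono] prod_mono prod_pos) auto
        then show ?thesis ..
      qed
    qed
  qed
  show ?thesis
    unfolding strict_cross_t_star_def
  proof (intro allI impI conjI)
    fix \<A> assume "cross_t_intersecting t k \<A> \<and> below k \<A> \<F>"
    note main = main[OF conjunct1[OF this] conjunct2[OF this]]
    show "(\<Prod>i=1..k. card (\<A> i)) \<le> (\<Prod>i=1..k. ?l i)"
      using main
    proof
      assume "\<exists>T. finite T \<and> card T = t \<and> (\<forall>i\<in>{1..k}. \<A> i = star (\<F> i) T)"
      then show ?thesis
        using card_star_le_max_star[OF fin] by (metis (no_types, lifting) prod_mono zero_le)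
    qed simp
    show "(\<Prod>i=1..k. card (\<A> i)) < (\<Prod>i=1..k. ?l i)"
      if "\<nexists>T. finite T \<and> card T = t \<and> (\<forall>i\<in>{1..k}. \<A> i = star (\<F> i) T)"
      using main that by blast
  qed
qed

end
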